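(* The best competitive ratio $\pi^*$ achievable by any online algorithm for the online PMD problem is given by $$\pi^*=\max_{\mathcal{I}\in\{[t]\,:\,t=\tau+1,\dots,T\}}\textsf{CR-Compute}(\mathcal{I}),\qquad\text{where }\tau=\lfloor c/\overline{d}\rfloor.$$
   Context: Fix a positive integer $T$, a storage capacity $c>0$, a per-slot discharge limit $\bar{\delta}\in(0,\infty]$, and demand bounds $0<\underline{d}\le\overline{d}$, with the standing assumption $c\le T\underline{d}$. Let $[t]=\{1,\dots,t\}$ and $\mathcal{D}=\{\bm x\in\mathbb{R}^T: \underline{d}\le x_t\le\overline{d}\ \forall t\in[T]\}$. For $\bm d\in\mathcal{D}$, the PMD problem is $\min_{\bm\delta\in\mathbb{R}^T}\max_{t\in[T]}(d_t-\delta_t)$ subject to $\sum_{t=1}^T\delta_t\le c$ and $0\le\delta_t\le\min\{\bar{\delta},d_t\}$ for all $t$; its optimal value is $v(\bm d)$. In the online PMD problem demands are revealed one at a time and irrevocable decisions $\delta_t$ (depending only on $d_1,\dots,d_t$) must be made, yielding a feasible solution for every $\bm d\in\mathcal{D}$; the competitive ratio of a deterministic online algorithm is the maximum over $\bm d\in\mathcal{D}$ of its peak $\max_t(d_t-\delta_t)$ divided by $v(\bm d)$, and for a randomized algorithm (a distribution over deterministic ones) the expected peak is used; the best competitive ratio is the smallest over all such algorithms. For a nonempty $\mathcal{I}\subseteq[T]$, \textsf{CR-Compute}($\mathcal{I}$) denotes the optimal value of the linear-fractional program $$\max_{\bm x\in\mathcal{D},\,u_i,\,\delta_{ij}}\ \frac{\sum_{i\in\mathcal{I}}x_i-c}{\sum_{i\in\mathcal{I}}u_i}$$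 subject to $\sum_{j=1}^T\delta_{ij}=c$ for all $i\in[T]$; $0\le\delta_{ij}\le\bar{\delta}$ for all $i,j\in[T]$; $x_j-\delta_{ij}\le u_i$ for all $1\le j\le i\le T$; and $\underline{d}-\delta_{ij}\le u_i$ for all $1\le i<j\le T$.
   Formalization: Assumes additionally that c ≤ T·δ̄ (otherwise every CR-Compute program is infeasible, though π* = 1) and that τ < T (fails only when c = T·d̲ = T·d̄, where the maximum is over an empty family). *)

theory Defs
  imports "HOL-Probability.Probability"
begin

text \<open>
  Vectors indexed by the slots 1, ..., T are functions on nat of which only the values on
  \<^term>\<open>{1..T}\<close> matter; demand vectors are extensional, so that \<open>demands\<close> is exactly the box.
  The discharge limit \<open>dbar\<close> is an extended real because it may be infinite.
\<close>

definition demands :: "nat \<Rightarrow> real \<Rightarrow> real \<Rightarrow> (nat \<Rightarrow> real) set" where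
  "demands T dlo dhi = PiE {1..T} (\<lambda>_. {dlo..dhi})"

definition pmd_feasible ::
  "nat \<Rightarrow> real \<Rightarrow> ereal \<Rightarrow> (nat \<Rightarrow> real) \<Rightarrow> (nat \<Rightarrow> real) set" where
  "pmd_feasible T c dbar d =
     {\<delta>. (\<Sum>t=1..T. \<delta> t) \<le> c \<and>
         (\<forall>t\<in>{1..T}. 0 \<le> \<delta> t \<and> ereal (\<delta> t) \<le> min dbar (ereal (d t)))}"

definition peak :: "nat \<Rightarrow> (nat \<Rightarrow> real) \<Rightarrow> (nat \<Rightarrow> real) \<Rightarrow> real" where
  "peak T d \<delta> = (MAX t\<in>{1..T}. d t - \<delta> t)"

definition pmd_value :: "nat \<Rightarrow> real \<Rightarrow> ereal \<Rightarrow> (nat \<Rightarrow> real) \<Rightarrow> real" where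
  "pmd_value T c dbar d = (INF \<delta>\<in>pmd_feasible T c dbar d. peak T d \<delta>)"

text \<open>
  A deterministic online algorithm maps the list of demands revealed so far to the current
  decision, so the decision in slot t depends on the demands in slots 1, ..., t only.
\<close>

type_synonym policy = "real list \<Rightarrow> real"

definition history :: "(nat \<Rightarrow> real) \<Rightarrow> nat \<Rightarrow> real list" where
  "history d t = map d [1..<Suc t]"

definition decisions :: "policy \<Rightarrow> (nat \<Rightarrow> real) \<Rightarrow> nat \<Rightarrow> real" where
  "decisions A d t = A (history d t)"

definition online_algorithms ::
  "nat \<Rightarrow> real \<Rightarrow> ereal \<Rightarrow> real \<Rightarrow> real \<Rightarrow> policy set" where
  "online_algorithms T c dbar dlo dhi =
     {A. \<forall>d\<in>demands T dlo dhi. decisions A d \<in> pmd_feasible T c dbar d}"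

text \<open>
  A randomized algorithm is a probability measure on (a set of) feasible deterministic
  algorithms. Its sigma-algebra is arbitrary, except that each single decision has to be a
  random variable, which makes the expected peak meaningful.
\<close>

definition randomized_algorithms ::
  "nat \<Rightarrow> real \<Rightarrow> ereal \<Rightarrow> real \<Rightarrow> real \<Rightarrow> policy measure set" where
  "randomized_algorithms T c dbar dlo dhi =
     {M. prob_space M \<and> space M \<subseteq> online_algorithms T c dbar dlo dhi \<and>
         (\<forall>d\<in>demands T dlo dhi. \<forall>t\<in>{1..T}. (\<lambda>A. decisions A d t) \<in> borel_measurable M)}"

text \<open>
  Quotients are taken in \<^typ>\<open>ereal\<close>: if the offline optimum is 0 (possible only if
  \<open>c = T * dlo\<close>), the ratio is \<open>\<infinity>\<close> for a positive peak, and 0 for a zero peak.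
\<close>

definition competitive_ratio ::
  "nat \<Rightarrow> real \<Rightarrow> ereal \<Rightarrow> real \<Rightarrow> real \<Rightarrow> policy \<Rightarrow> ereal" where
  "competitive_ratio T c dbar dlo dhi A =
     (SUP d\<in>demands T dlo dhi.
        ereal (peak T d (decisions A d)) / ereal (pmd_value T c dbar d))"

definition randomized_competitive_ratio ::
  "nat \<Rightarrow> real \<Rightarrow> ereal \<Rightarrow> real \<Rightarrow> real \<Rightarrow> policy measure \<Rightarrow> ereal" where
  "randomized_competitive_ratio T c dbar dlo dhi M =
     (SUP d\<in>demands T dlo dhi.
        ereal (\<integral>A. peak T d (decisions A d) \<partial>M) / ereal (pmd_value T c dbar d))"

definition achievable_ratios ::
  "nat \<Rightarrow> real \<Rightarrow> ereal \<Rightarrow> real \<Rightarrow> real \<Rightarrow> ereal set" where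
  "achievable_ratios T c dbar dlo dhi =
     competitive_ratio T c dbar dlo dhi ` online_algorithms T c dbar dlo dhi \<union>
     randomized_competitive_ratio T c dbar dlo dhi ` randomized_algorithms T c dbar dlo dhi"

definition best_competitive_ratio ::
  "nat \<Rightarrow> real \<Rightarrow> ereal \<Rightarrow> real \<Rightarrow> real \<Rightarrow> ereal" where
  "best_competitive_ratio T c dbar dlo dhi = Inf (achievable_ratios T c dbar dlo dhi)"

definition cr_feasible ::
  "nat \<Rightarrow> real \<Rightarrow> ereal \<Rightarrow> real \<Rightarrow> real \<Rightarrow>
   ((nat \<Rightarrow> real) \<times> (nat \<Rightarrow> real) \<times> (nat \<Rightarrow> nat \<Rightarrow> real)) set" where
  "cr_feasible T c dbar dlo dhi =
     {(x, u, \<delta>). x \<in> demands T dlo dhi \<and>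
        (\<forall>i\<in>{1..T}. (\<Sum>j=1..T. \<delta> i j) = c) \<and>
        (\<forall>i\<in>{1..T}. \<forall>j\<in>{1..T}. 0 \<le> \<delta> i j \<and> ereal (\<delta> i j) \<le> dbar) \<and>
        (\<forall>i\<in>{1..T}. \<forall>j\<in>{1..i}. x j - \<delta> i j \<le> u i) \<and>
        (\<forall>i\<in>{1..T}. \<forall>j\<in>{i<..T}. dlo - \<delta> i j \<le> u i)}"

text \<open>
  The constraints force every \<open>u i\<close> to be nonnegative, and positive unless \<open>c = T * dlo\<close>.
  If the denominator does vanish then the numerator is at most 0, so with
  the \<^typ>\<open>ereal\<close> quotient such a point contributes only 0 or \<open>-\<infinity>\<close>.
\<close>

definition CR_Compute ::
  "nat \<Rightarrow> real \<Rightarrow> ereal \<Rightarrow> real \<Rightarrow> real \<Rightarrow> nat set \<Rightarrow> ereal" where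
  "CR_Compute T c dbar dlo dhi I =
     (SUP (x, u, \<delta>)\<in>cr_feasible T c dbar dlo dhi.
        ereal ((\<Sum>i\<in>I. x i) - c) / ereal (\<Sum>i\<in>I. u i))"

end

theory Submission
  imports Defs
begin

text \<open>
  Any algorithm of ratio \<open>\<rho>\<close> must, on the demands \<open>x\<^sub>1, \<dots>, x\<^sub>i, dlo, \<dots>, dlo\<close>, have (expected)
  peak at most \<open>\<rho>\<close> times the offline optimum, which is at most \<open>u\<^sub>i\<close>. Its decision in slot \<open>i\<close> is the
  same for all longer prefixes of \<open>x\<close>, so summing over \<open>i \<le> t\<close> shows that
  \<open>x\<^sub>1 + \<dots> + x\<^sub>t - c \<le> \<rho> (u\<^sub>1 + \<dots> + u\<^sub>t)\<close>. Conversely, let \<open>\<pi>\<close> be the right-hand side and discharge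
  in slot \<open>t\<close> just enough to bring the peak down to \<open>\<pi>\<close> times the optimum for
  \<open>d\<^sub>1, \<dots>, d\<^sub>t, dlo, \<dots>, dlo\<close>. Moving the slots with a positive discharge to the front does not
  increase any of these optima, so the program for an initial segment bounds the total discharge
  by \<open>c\<close>.
\<close>

section \<open>Truncated demands and attainable offline peaks\<close>

definition prefix_demand :: "nat \<Rightarrow> real \<Rightarrow> nat \<Rightarrow> (nat \<Rightarrow> real) \<Rightarrow> nat \<Rightarrow> real" where
  "prefix_demand T dlo i d = (\<lambda>j\<in>{1..T}. if j \<le> i then d j else dlo)"

text \<open>Attainability of the offline peak \<open>u\<close> with the discharges eliminated:
  \<open>max 0 (d j - u)\<close> is the least discharge that works in slot \<open>j\<close>, so only
  its limit and the budget remain to be checked. The cap of a discharge by the demand turns into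
  \<open>0 \<le> u\<close>.\<close>

definition level :: "nat \<Rightarrow> real \<Rightarrow> ereal \<Rightarrow> (nat \<Rightarrow> real) \<Rightarrow> real \<Rightarrow> bool" where
  "level T c dbar d u \<longleftrightarrow> 0 \<le> u \<and> (\<forall>j\<in>{1..T}. ereal (d j - u) \<le> dbar) \<and>
     (\<Sum>j=1..T. max 0 (d j - u)) \<le> c"

lemma demandsD: "d \<in> demands T dlo dhi \<Longrightarrow> j \<in> {1..T} \<Longrightarrow> dlo \<le> d j \<and> d j \<le> dhi"
  unfolding demands_def by (auto dest!: PiE_mem)

lemma prefix_demand_in_demands:
  assumes "d \<in> demands T dlo dhi" "dlo \<le> dhi"
  shows "prefix_demand T dlo i d \<in> demands T dlo dhi"
  using assms demandsD[OF assms(1)]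
  unfolding demands_def prefix_demand_def by (auto simp: PiE_iff)

lemma prefix_demand_le:
  assumes "d \<in> demands T dlo dhi" "j \<in> {1..T}"
  shows "prefix_demand T dlo i d j \<le> d j"
  using assms demandsD[OF assms] unfolding prefix_demand_def by auto

lemma history_nth: "1 \<le> j \<Longrightarrow> j \<le> t \<Longrightarrow> history d t ! (j - 1) = d j"
  by (simp add: history_def del: upt_Suc)

text \<open>The online property enters here: the decision in slot \<open>t\<close> cannot tell
  \<open>d\<close> from its truncation at any \<open>i \<ge> t\<close>.\<close>

lemma decisions_prefix_demand:
  assumes "t \<le> i" "t \<le> T"
  shows "decisions A (prefix_demand T dlo i d) t = decisions A d t"
proof -
  have "history (prefix_demand T dlo i d) t = history d t"
    unfolding history_def using assms by (intro map_cong) (auto simp: prefix_demand_def)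
  then show ?thesis by (simp add: decisions_def)
qed

lemma peak_ge: "t \<in> {1..T} \<Longrightarrow> d t - \<delta> t \<le> peak T d \<delta>"
  unfolding peak_def by (intro Max_ge) auto

lemma peak_le:
  assumes "T > 0" "\<And>t. t \<in> {1..T} \<Longrightarrow> d t - \<delta> t \<le> u"
  shows "peak T d \<delta> \<le> u"
  unfolding peak_def using assms by (subst Max_le_iff) auto

lemma level_mono:
  assumes "level T c dbar e u" "\<And>j. j \<in> {1..T} \<Longrightarrow> d j \<le> e j"
  shows "level T c dbar d u"
proof -
  have "(\<Sum>j=1..T. max 0 (d j - u)) \<le> (\<Sum>j=1..T. max 0 (e j - u))"
    by (rule sum_mono) (use assms(2) in force)
  moreover have "ereal (d j - u) \<le> dbar" if "j \<in> {1..T}" for j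
  proof -
    have "ereal (d j - u) \<le> ereal (e j - u)" using assms(2)[OF that] by simp
    also have "\<dots> \<le> dbar" using assms(1) that by (simp add: level_def)
    finally show ?thesis .
  qed
  ultimately show ?thesis using assms(1) by (simp add: level_def)
qed

text \<open>Closedness makes the infimum of the attainable peaks attainable itself.\<close>

lemma closed_level: "closed {u. level T c dbar d u}"
proof -
  have "closed ({0..} \<inter> (\<Inter>j\<in>{1..T}. {u. ereal (d j - u) \<le> dbar}) \<inter>
      {u. (\<Sum>j=1..T. max 0 (d j - u)) \<le> c})"
    by (intro closed_Int closed_INT ballI closed_Collect_le closed_atLeast continuous_intros)
  also have "({0..} \<inter> (\<Inter>j\<in>{1..T}. {u. ereal (d j - u) \<le> dbar}) \<inter>
      {u. (\<Sum>j=1..T. max 0 (d j - u)) \<le> c}) = {u. level T c dbar d u}"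
    by (auto simp: level_def)
  finally show ?thesis .
qed

lemma decisions_nonneg_le:
  assumes "A \<in> online_algorithms T c dbar dlo dhi" "d \<in> demands T dlo dhi" "t \<in> {1..T}"
  shows "0 \<le> decisions A d t" "decisions A d t \<le> d t"
  using assms unfolding online_algorithms_def pmd_feasible_def by auto

text \<open>The programs require every row to discharge exactly \<open>c\<close>, whereas least
  discharges may add up to less. Moving from \<open>a\<close> towards a constant vector
  \<open>b\<close> raises the total continuously until it reaches \<open>c\<close>.\<close>

lemma exists_fill_up:
  fixes a :: "nat \<Rightarrow> real" and dbar :: ereal
  assumes "T > 0" and a: "\<And>j. j \<in> {1..T} \<Longrightarrow> 0 \<le> a j \<and> ereal (a j) \<le> dbar"
    and sum_a: "(\<Sum>j=1..T. a j) \<le> c" and cap: "ereal c \<le> ereal (real T) * dbar"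
    and "dbar > 0"
  obtains \<delta> where "(\<Sum>j=1..T. \<delta> j) = c"
    "\<And>j. j \<in> {1..T} \<Longrightarrow> a j \<le> \<delta> j \<and> ereal (\<delta> j) \<le> dbar"
proof -
  \<comment> \<open>A finite stand-in for \<open>dbar\<close>: its value if it is finite, and
    \<open>c\<close> otherwise, since no \<open>a j\<close> exceeds the total.\<close>
  obtain b where b: "ereal b \<le> dbar" "c \<le> real T * b" "\<And>j. j \<in> {1..T} \<Longrightarrow> a j \<le> b"
  proof (cases dbar)
    case (real r)
    then show ?thesis using that[of r] a cap by auto
  next
    case PInf
    have c0: "0 \<le> c" using sum_a a by (meson order_trans sum_nonneg)
    have "a j \<le> c" if "j \<in> {1..T}" for j
      using member_le_sum[OF that, of a] a sum_a by force
    moreover have "c \<le> real T * c"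
      using c0 \<open>T > 0\<close> by (simp add: mult_le_cancel_right1)
    ultimately show ?thesis using that[of c] PInf by simp
  next
    case MInf
    then show ?thesis using \<open>dbar > 0\<close> by simp
  qed
  define s where "s = (\<Sum>j=1..T. a j)"
  \<comment> \<open>The position on the segment at which the total is \<open>c\<close>. If the
    denominator is 0, then \<open>s = c\<close> already and the default quotient 0 does no
    harm.\<close>
  define \<theta> where "\<theta> = (c - s) / (real T * b - s)"
  have sb: "s \<le> c" "c \<le> real T * b" using sum_a b by (auto simp: s_def)
  have \<theta>: "0 \<le> \<theta>" "\<theta> \<le> 1" using sb unfolding \<theta>_def by (auto simp: divide_le_eq_1)
  define \<delta> where "\<delta> = (\<lambda>j. a j + \<theta> * (b - a j))"
  have "(\<Sum>j=1..T. \<delta> j) = s + \<theta> * (real T * b - s)"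
    by (simp add: \<delta>_def s_def sum.distrib sum_distrib_left[symmetric] sum_subtractf)
  also have "\<dots> = c" using sb by (cases "real T * b = s") (auto simp: \<theta>_def)
  finally have "(\<Sum>j=1..T. \<delta> j) = c" .
  moreover have "a j \<le> \<delta> j \<and> ereal (\<delta> j) \<le> dbar" if j: "j \<in> {1..T}" for j
  proof
    show "a j \<le> \<delta> j" using \<theta> b(3)[OF j] by (simp add: \<delta>_def)
    have "\<theta> * (b - a j) \<le> 1 * (b - a j)"
      using \<theta> b(3)[OF j] by (intro mult_right_mono) auto
    then have "\<delta> j \<le> b" by (simp add: \<delta>_def)
    then show "ereal (\<delta> j) \<le> dbar" using b(1) by (meson ereal_less_eq(3) order_trans)
  qed
  ultimately show ?thesis using that by blast
qed

text \<open>Lets one lower bound argument cover both kinds of algorithms; on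
  \<open>count_space {A}\<close> measurability is automatic.\<close>

lemma deterministic_as_randomized:
  assumes "A \<in> online_algorithms T c dbar dlo dhi"
  defines "M \<equiv> return (count_space {A}) A"
  shows "M \<in> randomized_algorithms T c dbar dlo dhi"
    "randomized_competitive_ratio T c dbar dlo dhi M = competitive_ratio T c dbar dlo dhi A"
proof -
  show "M \<in> randomized_algorithms T c dbar dlo dhi"
    using assms by (auto simp: randomized_algorithms_def intro!: prob_space_return)
  have "(\<integral>B. peak T d (decisions B d) \<partial>M) = peak T d (decisions A d)" for d
    unfolding M_def by (rule integral_return) auto
  then show "randomized_competitive_ratio T c dbar dlo dhi M = competitive_ratio T c dbar dlo dhi A"
    by (simp add: randomized_competitive_ratio_def competitive_ratio_def)
qed

section \<open>The offline optimum as the least attainable peak\<close>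

locale pmd =
  fixes T :: nat and c dlo dhi :: real and dbar :: ereal
  assumes T_pos: "T > 0" and c_pos: "c > 0" and dbar_pos: "dbar > 0"
    and dlo_pos: "0 < dlo" and dlo_le_dhi: "dlo \<le> dhi"
    and c_le: "c \<le> real T * dlo"
    and c_le_dbar: "ereal c \<le> ereal (real T) * dbar"
begin

abbreviation "D \<equiv> demands T dlo dhi"
abbreviation "v \<equiv> pmd_value T c dbar"
abbreviation "pre \<equiv> prefix_demand T dlo"

lemma peak_nonneg:
  assumes "\<delta> \<in> pmd_feasible T c dbar d"
  shows "0 \<le> peak T d \<delta>"
proof -
  have "1 \<in> {1..T}" using T_pos by simp
  then have "0 \<le> d 1 - \<delta> 1" "d 1 - \<delta> 1 \<le> peak T d \<delta>"
    using assms peak_ge[of 1 T d \<delta>] by (auto simp: pmd_feasible_def)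
  then show ?thesis by linarith
qed

text \<open>A feasible \<open>\<delta>\<close> dominates the least discharges for its own peak, so
  it passes its budget and limits on to them.\<close>

lemma level_peak:
  assumes "\<delta> \<in> pmd_feasible T c dbar d"
  shows "level T c dbar d (peak T d \<delta>)"
proof -
  have le: "d j - peak T d \<delta> \<le> \<delta> j" if "j \<in> {1..T}" for j
    using peak_ge[OF that, of d \<delta>] by simp
  have "(\<Sum>j=1..T. max 0 (d j - peak T d \<delta>)) \<le> (\<Sum>j=1..T. \<delta> j)"
    by (rule sum_mono) (use assms le in \<open>auto simp: pmd_feasible_def\<close>)
  moreover have "ereal (d j - peak T d \<delta>) \<le> dbar" if "j \<in> {1..T}" for j
  proof -
    have "ereal (d j - peak T d \<delta>) \<le> ereal (\<delta> j)" using le[OF that] by simp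
    also have "\<dots> \<le> dbar" using assms that by (auto simp: pmd_feasible_def)
    finally show ?thesis .
  qed
  ultimately show ?thesis using assms peak_nonneg[OF assms] by (auto simp: level_def pmd_feasible_def)
qed

text \<open>The least discharges for \<open>u\<close> form a feasible solution.\<close>

lemma pmd_value_le:
  assumes "d \<in> D" "level T c dbar d u"
  shows "v d \<le> u"
proof -
  define \<delta> where "\<delta> = (\<lambda>j. max 0 (d j - u))"
  have "ereal (\<delta> j) \<le> min dbar (ereal (d j))" if "j \<in> {1..T}" for j
    using assms that demandsD[OF assms(1) that] dlo_pos dbar_pos
    by (auto simp: \<delta>_def level_def max_def zero_ereal_def[symmetric])
  then have "\<delta> \<in> pmd_feasible T c dbar d"
    using assms by (auto simp: pmd_feasible_def \<delta>_def level_def)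
  moreover have "peak T d \<delta> \<le> u"
    by (rule peak_le[OF T_pos]) (auto simp: \<delta>_def)
  moreover have "bdd_below (peak T d ` pmd_feasible T c dbar d)"
    by (rule bdd_belowI[of _ 0]) (auto intro: peak_nonneg)
  ultimately show ?thesis unfolding pmd_value_def by (intro cINF_lower2)
qed

text \<open>The optimum is attained, because the attainable peaks form a closed set that is bounded
  below by 0 and contains \<open>dhi\<close>.\<close>

lemma level_pmd_value:
  assumes "d \<in> D"
  shows "level T c dbar d (v d)"
proof -
  define L where "L = {u. level T c dbar d u}"
  have "(\<Sum>j=1..T. max 0 (d j - dhi)) = 0"
    by (rule sum.neutral) (use demandsD[OF assms] in force)
  moreover have "ereal (d j - dhi) \<le> dbar" if "j \<in> {1..T}" for j
  proof -
    have "ereal (d j - dhi) \<le> 0" using demandsD[OF assms that] by simp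
    then show ?thesis using dbar_pos by (meson less_imp_le order_trans)
  qed
  ultimately have "dhi \<in> L" using c_pos dlo_pos dlo_le_dhi by (simp add: L_def level_def)
  have bdd: "bdd_below L" by (rule bdd_belowI[of _ 0]) (auto simp: L_def level_def)
  have Inf_L: "Inf L \<in> L"
    by (rule closed_contains_Inf) (use bdd \<open>dhi \<in> L\<close> closed_level in \<open>auto simp: L_def\<close>)
  have "(\<lambda>_. 0) \<in> pmd_feasible T c dbar d"
    using c_pos dbar_pos dlo_pos demandsD[OF assms]
    by (force simp: pmd_feasible_def zero_ereal_def[symmetric])
  then have "Inf L \<le> v d"
    unfolding pmd_value_def
    by (intro cINF_greatest cInf_lower bdd) (auto simp: L_def intro: level_peak)
  moreover have "v d \<le> Inf L" using pmd_value_le[OF assms] Inf_L by (simp add: L_def)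
  ultimately have "v d = Inf L" by simp
  then show ?thesis using Inf_L unfolding L_def by (metis mem_Collect_eq)
qed

lemma pmd_value_nonneg: "d \<in> D \<Longrightarrow> 0 \<le> v d"
  using level_pmd_value by (simp add: level_def)

section \<open>Feasible points and values of the programs\<close>

lemma cr_feasible_bounds:
  assumes "(x, u, \<delta>) \<in> cr_feasible T c dbar dlo dhi" "i \<in> {1..T}"
  shows "0 \<le> u i" "(\<Sum>j=1..i. x j) - c \<le> real T * u i"
proof -
  have x: "x \<in> D" using assms by (simp add: cr_feasible_def)
  \<comment> \<open>Row \<open>i\<close> brings the demands \<open>pre i x\<close> down to
    \<open>u i\<close>. Summing over all slots bounds their total by \<open>c + T * u i\<close>,
    while this total is at least \<open>T * dlo\<close> and hence at least \<open>c\<close>.\<close>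
  have "pre i x j \<le> \<delta> i j + u i" if "j \<in> {1..T}" for j
    using assms that by (auto simp: cr_feasible_def prefix_demand_def algebra_simps)
  then have "(\<Sum>j=1..T. pre i x j) \<le> (\<Sum>j=1..T. \<delta> i j + u i)" by (rule sum_mono)
  also have "\<dots> = c + real T * u i" using assms by (simp add: sum.distrib cr_feasible_def)
  finally have *: "(\<Sum>j=1..T. pre i x j) \<le> c + real T * u i" .
  have ge: "dlo \<le> pre i x j" if "j \<in> {1..T}" for j
    using demandsD[OF prefix_demand_in_demands[OF x dlo_le_dhi] that] by simp
  have "real T * dlo = (\<Sum>j=1..T. dlo)" by simp
  also have "\<dots> \<le> (\<Sum>j=1..T. pre i x j)" using ge by (rule sum_mono)
  finally have "0 \<le> real T * u i" using * c_le by linarith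
  then show "0 \<le> u i" using T_pos by (simp add: zero_le_mult_iff)
  have "(\<Sum>j=1..i. x j) = (\<Sum>j=1..i. pre i x j)"
    by (rule sum.cong) (use assms in \<open>auto simp: prefix_demand_def\<close>)
  also have "\<dots> \<le> (\<Sum>j=1..T. pre i x j)"
    by (rule sum_mono2) (use assms ge dlo_pos in \<open>auto intro: order_trans[OF less_imp_le]\<close>)
  finally show "(\<Sum>j=1..i. x j) - c \<le> real T * u i" using * by linarith
qed

text \<open>Row \<open>i\<close> of \<open>\<delta>\<close> dominates the least discharges that
  reach level \<open>u i\<close> on \<open>pre i x\<close>.\<close>

lemma pmd_value_le_cr_feasible:
  assumes "(x, u, \<delta>) \<in> cr_feasible T c dbar dlo dhi" "i \<in> {1..T}"
  shows "v (pre i x) \<le> u i"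
proof (rule pmd_value_le)
  have x: "x \<in> D" using assms by (simp add: cr_feasible_def)
  then show "pre i x \<in> D" using dlo_le_dhi by (rule prefix_demand_in_demands)
  have le: "pre i x j - u i \<le> \<delta> i j" if "j \<in> {1..T}" for j
    using assms that by (auto simp: cr_feasible_def prefix_demand_def algebra_simps)
  have "(\<Sum>j=1..T. max 0 (pre i x j - u i)) \<le> (\<Sum>j=1..T. \<delta> i j)"
    by (rule sum_mono) (use assms le in \<open>auto simp: cr_feasible_def\<close>)
  also have "\<dots> = c" using assms by (simp add: cr_feasible_def)
  finally have "(\<Sum>j=1..T. max 0 (pre i x j - u i)) \<le> c" .
  moreover have "ereal (pre i x j - u i) \<le> dbar" if "j \<in> {1..T}" for j
  proof -
    have "ereal (pre i x j - u i) \<le> ereal (\<delta> i j)" using le[OF that] by simp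
    also have "\<dots> \<le> dbar" using assms that by (auto simp: cr_feasible_def)
    finally show ?thesis .
  qed
  ultimately show "level T c dbar (pre i x) (u i)"
    using cr_feasible_bounds[OF assms] by (simp add: level_def)
qed

text \<open>Least discharges for the optima, filled up to total \<open>c\<close>, serve as rows. By
  the previous lemma these optima are the smallest \<open>u\<close> possible for the given
  \<open>x\<close>.\<close>

lemma cr_feasible_of_pmd_value:
  assumes "x \<in> D"
  shows "\<exists>\<delta>. (x, \<lambda>i. v (pre i x), \<delta>) \<in> cr_feasible T c dbar dlo dhi"
proof -
  have "\<exists>e. (\<Sum>j=1..T. e j) = c \<and>
      (\<forall>j\<in>{1..T}. max 0 (pre i x j - v (pre i x)) \<le> e j \<and> ereal (e j) \<le> dbar)" for i
  proof -
    have "level T c dbar (pre i x) (v (pre i x))"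
      by (intro level_pmd_value prefix_demand_in_demands assms dlo_le_dhi)
    then have le: "(\<Sum>j=1..T. max 0 (pre i x j - v (pre i x))) \<le> c"
      and bd: "\<forall>j\<in>{1..T}. ereal (pre i x j - v (pre i x)) \<le> dbar"
      by (simp_all add: level_def)
    have "0 \<le> max 0 (pre i x j - v (pre i x)) \<and> ereal (max 0 (pre i x j - v (pre i x))) \<le> dbar"
      if "j \<in> {1..T}" for j
      using bd that dbar_pos[THEN less_imp_le] by (auto simp: max_def zero_ereal_def[symmetric])
    then obtain e where "(\<Sum>j=1..T. e j) = c"
      "\<And>j. j \<in> {1..T} \<Longrightarrow> max 0 (pre i x j - v (pre i x)) \<le> e j \<and> ereal (e j) \<le> dbar"
      using exists_fill_up[OF T_pos _ le c_le_dbar dbar_pos] by (auto simp del: max.bounded_iff)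
    then show ?thesis by blast
  qed
  then obtain \<delta> where \<delta>: "\<And>i. (\<Sum>j=1..T. \<delta> i j) = c"
    "\<And>i j. j \<in> {1..T} \<Longrightarrow> max 0 (pre i x j - v (pre i x)) \<le> \<delta> i j \<and> ereal (\<delta> i j) \<le> dbar"
    by metis
  have le: "pre i x j - \<delta> i j \<le> v (pre i x)" if "j \<in> {1..T}" for i j
    using \<delta>(2)[OF that, of i] by simp
  have "x j - \<delta> i j \<le> v (pre i x)" if "i \<in> {1..T}" "j \<in> {1..i}" for i j
    using le[of j i] that by (auto simp: prefix_demand_def)
  moreover have "dlo - \<delta> i j \<le> v (pre i x)" if "i \<in> {1..T}" "j \<in> {i<..T}" for i j
    using le[of j i] that by (auto simp: prefix_demand_def)
  moreover have "0 \<le> \<delta> i j" if "j \<in> {1..T}" for i j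
    using \<delta>(2)[OF that, of i] by simp
  ultimately have "(x, \<lambda>i. v (pre i x), \<delta>) \<in> cr_feasible T c dbar dlo dhi"
    using assms \<delta> by (simp add: cr_feasible_def)
  then show ?thesis by blast
qed

lemma CR_Compute_le:
  assumes "t \<in> {1..T}"
    and "\<And>x u \<delta>. (x, u, \<delta>) \<in> cr_feasible T c dbar dlo dhi \<Longrightarrow>
      (\<Sum>i=1..t. x i) - c \<le> r * (\<Sum>i=1..t. u i)"
    and "0 \<le> r"
  shows "CR_Compute T c dbar dlo dhi {1..t} \<le> ereal r"
  unfolding CR_Compute_def
proof (rule SUP_least, clarify)
  fix x u \<delta> assume f: "(x, u, \<delta>) \<in> cr_feasible T c dbar dlo dhi"
  have "0 \<le> sum u {1..t}"
    by (rule sum_nonneg) (use cr_feasible_bounds(1)[OF f] assms(1) in auto)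
  then show "ereal (sum x {1..t} - c) / ereal (sum u {1..t}) \<le> ereal r"
    using assms(2)[OF f] \<open>0 \<le> r\<close>
    \<comment> \<open>If the denominator is 0, the numerator is at most 0 and the quotient is 0 or
      \<open>-\<infinity>\<close>.\<close>
    by (cases "sum u {1..t} = 0") (auto simp: divide_ereal_def field_simps)
qed

text \<open>Together with \<open>CR_Compute_le\<close> this replaces the extended real quotients by
  linear inequalities.\<close>

lemma CR_Compute_geD:
  assumes "t \<in> {1..T}" "CR_Compute T c dbar dlo dhi {1..t} \<le> ereal r"
    and f: "(x, u, \<delta>) \<in> cr_feasible T c dbar dlo dhi"
  shows "(\<Sum>i=1..t. x i) - c \<le> r * (\<Sum>i=1..t. u i)"
proof -
  have u0: "\<And>i. i \<in> {1..t} \<Longrightarrow> 0 \<le> u i"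
    using cr_feasible_bounds(1)[OF f] assms(1) by auto
  then have ge: "0 \<le> sum u {1..t}" by (rule sum_nonneg)
  have "ereal (sum x {1..t} - c) / ereal (sum u {1..t}) \<le> ereal r"
    using SUP_upper[OF f, of "\<lambda>(x, u, \<delta>). ereal (sum x {1..t} - c) / ereal (sum u {1..t})"]
      assms(2) unfolding CR_Compute_def by simp
  \<comment> \<open>For a zero denominator the claim follows from row \<open>t\<close> alone, since
    \<open>u t = 0\<close>.\<close>
  moreover have "sum x {1..t} - c \<le> 0" if "sum u {1..t} = 0"
  proof -
    have "u t = 0" using that u0 assms(1) by (subst (asm) sum_nonneg_eq_0_iff) auto
    then show ?thesis using cr_feasible_bounds(2)[OF f assms(1)] by simp
  qed
  ultimately show ?thesis
    using ge by (cases "sum u {1..t} = 0") (auto simp: field_simps)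
qed

text \<open>This crude bound keeps the maximum finite, so that it can be the real parameter of a
  policy. It uses row \<open>t\<close> only.\<close>

lemma CR_Compute_le_T:
  assumes t: "t \<in> {1..T}"
  shows "CR_Compute T c dbar dlo dhi {1..t} \<le> ereal (real T)"
proof (rule CR_Compute_le[OF t])
  fix x u \<delta> assume f: "(x, u, \<delta>) \<in> cr_feasible T c dbar dlo dhi"
  have "u t \<le> sum u {1..t}"
    by (rule member_le_sum) (use cr_feasible_bounds(1)[OF f] t in auto)
  then have "real T * u t \<le> real T * sum u {1..t}" by (intro mult_left_mono) auto
  then show "sum x {1..t} - c \<le> real T * sum u {1..t}"
    using cr_feasible_bounds(2)[OF f t] by linarith
qed simp

text \<open>The uniform discharge \<open>c / T\<close> has ratio 1; the last demand is raised so that the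
  denominator is positive even if \<open>c = T * dlo\<close>.\<close>

lemma one_le_CR_Compute:
  assumes "c < real T * dhi"
  shows "1 \<le> CR_Compute T c dbar dlo dhi {1..T}"
proof -
  define x where "x = (\<lambda>i\<in>{1..T}. if i = T then dhi else dlo)"
  define u where "u = (\<lambda>i. x i - c / real T)"
  define \<delta> where "\<delta> = (\<lambda>(i::nat) (j::nat). c / real T)"
  have x: "x \<in> D" using dlo_le_dhi by (auto simp: x_def demands_def PiE_iff)
  have "ereal (c / real T) \<le> dbar"
    using c_le_dbar T_pos dbar_pos by (cases dbar) (auto simp: field_simps)
  moreover have "x j \<le> x i" if "i \<in> {1..T}" "j \<in> {1..i}" for i j
    using that dlo_le_dhi by (auto simp: x_def)
  moreover have "dlo \<le> x i" if "i \<in> {1..T}" for i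
    using demandsD[OF x that] by simp
  ultimately have f: "(x, u, \<delta>) \<in> cr_feasible T c dbar dlo dhi"
    using x c_pos T_pos by (simp add: cr_feasible_def u_def \<delta>_def)
  have "{1..T} = insert T {1..<T}" using T_pos by auto
  moreover have "sum x {1..<T} = (\<Sum>i\<in>{1..<T}. dlo)" by (rule sum.cong) (auto simp: x_def)
  ultimately have sx: "sum x {1..T} = (real T - 1) * dlo + dhi"
    using T_pos by (simp add: x_def of_nat_diff)
  \<comment> \<open>For \<open>dlo = dhi\<close> this is the assumption; otherwise one demand
    strictly above \<open>dlo\<close> pushes the total above \<open>T * dlo\<close>.\<close>
  have "c < (real T - 1) * dlo + dhi"
    using assms c_le dlo_le_dhi by (cases "dlo = dhi") (auto simp: algebra_simps)
  moreover have "sum u {1..T} = sum x {1..T} - c"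
    using T_pos by (simp add: u_def sum_subtractf)
  ultimately have "1 = ereal (sum x {1..T} - c) / ereal (sum u {1..T})"
    using sx by (simp add: one_ereal_def)
  also have "\<dots> \<le> CR_Compute T c dbar dlo dhi {1..T}"
    unfolding CR_Compute_def
    using SUP_upper[OF f, of "\<lambda>(x, u, \<delta>). ereal (sum x {1..T} - c) / ereal (sum u {1..T})"]
    by simp
  finally show ?thesis .
qed

section \<open>The lower bound for randomized algorithms\<close>

lemma expected_peak_bounds:
  assumes M: "M \<in> randomized_algorithms T c dbar dlo dhi" and d: "d \<in> D" and t: "t \<in> {1..T}"
  shows "integrable M (\<lambda>A. decisions A d t)"
    and "0 \<le> (\<integral>A. peak T d (decisions A d) \<partial>M)"
    and "d t - (\<integral>A. decisions A d t \<partial>M) \<le> (\<integral>A. peak T d (decisions A d) \<partial>M)"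
proof -
  interpret prob_space M using M by (simp add: randomized_algorithms_def)
  have on: "A \<in> online_algorithms T c dbar dlo dhi" if "A \<in> space M" for A
    using M that by (auto simp: randomized_algorithms_def)
  have meas: "(\<lambda>A. decisions A d i) \<in> borel_measurable M" if "i \<in> {1..T}" for i
    using M d that by (auto simp: randomized_algorithms_def)
  have dec: "0 \<le> decisions A d i \<and> decisions A d i \<le> d i" if "A \<in> space M" "i \<in> {1..T}" for A i
    using decisions_nonneg_le[OF on d] that by auto
  \<comment> \<open>Measurable and bounded: decisions lie between 0 and the demand, and peaks
    between 0 and \<open>dhi\<close>.\<close>
  show int: "integrable M (\<lambda>A. decisions A d t)"
    by (rule integrable_const_bound[where B = "d t"])
      (use dec t meas in \<open>auto intro!: AE_I2\<close>)
  have pk: "0 \<le> peak T d (decisions A d)" if "A \<in> space M" for A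
    using on[OF that] d by (intro peak_nonneg) (auto simp: online_algorithms_def)
  have pk_le: "peak T d (decisions A d) \<le> dhi" if "A \<in> space M" for A
    by (rule peak_le[OF T_pos]) (use dec[OF that] demandsD[OF d] in force)
  have "(\<lambda>A. peak T d (decisions A d)) \<in> borel_measurable M"
    unfolding peak_def
    by (rule borel_measurable_Max) (use meas in \<open>auto intro!: borel_measurable_diff\<close>)
  then have int': "integrable M (\<lambda>A. peak T d (decisions A d))"
    by (intro integrable_const_bound[where B = dhi]) (use pk pk_le in \<open>auto intro!: AE_I2\<close>)
  show "0 \<le> (\<integral>A. peak T d (decisions A d) \<partial>M)"
    by (rule Bochner_Integration.integral_nonneg) (rule pk)
  have "d t - (\<integral>A. decisions A d t \<partial>M) = (\<integral>A. d t - decisions A d t \<partial>M)"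
    using int by (simp add: prob_space)
  also have "\<dots> \<le> (\<integral>A. peak T d (decisions A d) \<partial>M)"
    by (rule integral_mono) (use int int' t in \<open>auto intro: peak_ge\<close>)
  finally show "d t - (\<integral>A. decisions A d t \<partial>M) \<le> (\<integral>A. peak T d (decisions A d) \<partial>M)" .
qed

lemma randomized_lower_bound:
  assumes M: "M \<in> randomized_algorithms T c dbar dlo dhi" and t: "t \<in> {1..T}"
  shows "CR_Compute T c dbar dlo dhi {1..t} \<le> randomized_competitive_ratio T c dbar dlo dhi M"
proof -
  let ?E = "\<lambda>d. \<integral>A. peak T d (decisions A d) \<partial>M"
  interpret prob_space M using M by (simp add: randomized_algorithms_def)
  define R where "R = randomized_competitive_ratio T c dbar dlo dhi M"
  have R_ge: "ereal (?E d) / ereal (v d) \<le> R" if "d \<in> D" for d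
    unfolding R_def randomized_competitive_ratio_def using that by (rule SUP_upper)
  have T_mem: "T \<in> {1..T}" using T_pos by simp
  have dlo_mem: "(\<lambda>i\<in>{1..T}. dlo) \<in> D" using dlo_le_dhi by (simp add: demands_def)
  \<comment> \<open>One test demand suffices to see that the ratio is not negative. This leaves a
    finite \<open>R\<close>, or \<open>R = \<infinity>\<close>, where the claim is trivial.\<close>
  have "0 \<le> ereal (?E (\<lambda>i\<in>{1..T}. dlo)) / ereal (v (\<lambda>i\<in>{1..T}. dlo))"
    using expected_peak_bounds(2)[OF M dlo_mem T_mem] pmd_value_nonneg[OF dlo_mem]
    by (simp add: divide_ereal_def ereal_0_le_mult)
  then have R0: "0 \<le> R" using R_ge[OF dlo_mem] by (rule order_trans)
  show ?thesis
  proof (cases R)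
    case (real r)
    have E_le: "?E d \<le> r * v d" if d: "d \<in> D" for d
    proof (cases "v d = 0")
      case True
      \<comment> \<open>A positive expected peak against the optimum 0 would make the ratio
        infinite.\<close>
      have "\<not> 0 < ?E d" using R_ge[OF d] True real by (auto simp: divide_ereal_def)
      then show ?thesis using True by simp
    next
      case False
      then show ?thesis
        using R_ge[OF d] real pmd_value_nonneg[OF d] by (simp add: field_simps)
    qed
    have "CR_Compute T c dbar dlo dhi {1..t} \<le> ereal r"
    proof (rule CR_Compute_le[OF t])
      show "0 \<le> r" using R0 real by simp
      fix x u \<delta> assume f: "(x, u, \<delta>) \<in> cr_feasible T c dbar dlo dhi"
      have x: "x \<in> D" using f by (simp add: cr_feasible_def)
      have "x i - (\<integral>A. decisions A x i \<partial>M) \<le> r * u i" if i: "i \<in> {1..t}" for i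
      proof -
        have iT: "i \<in> {1..T}" using i t by auto
        have p: "pre i x \<in> D" using x dlo_le_dhi by (rule prefix_demand_in_demands)
        \<comment> \<open>Passing to \<open>pre i x\<close> leaves the demand and the decision in
          slot \<open>i\<close> unchanged, but the peak is now compared with the smaller optimum
          \<open>v (pre i x)\<close>.\<close>
        have "x i - (\<integral>A. decisions A x i \<partial>M) = pre i x i - (\<integral>A. decisions A (pre i x) i \<partial>M)"
          using iT by (simp add: decisions_prefix_demand) (simp add: prefix_demand_def)
        also have "\<dots> \<le> r * v (pre i x)"
          using expected_peak_bounds(3)[OF M p iT] E_le[OF p] by linarith
        also have "\<dots> \<le> r * u i"
          using pmd_value_le_cr_feasible[OF f iT] \<open>0 \<le> r\<close> by (rule mult_left_mono)
        finally show ?thesis .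
      qed
      then have "(\<Sum>i=1..t. x i - (\<integral>A. decisions A x i \<partial>M)) \<le> (\<Sum>i=1..t. r * u i)"
        by (rule sum_mono)
      \<comment> \<open>The budget holds for every outcome, hence also in expectation; the slots
        after \<open>t\<close> only add nonnegative discharges.\<close>
      moreover have "(\<Sum>i=1..t. \<integral>A. decisions A x i \<partial>M) \<le> c"
      proof -
        have int: "integrable M (\<lambda>A. decisions A x i)" if "i \<in> {1..t}" for i
          using expected_peak_bounds(1)[OF M x] that t by auto
        have "(\<Sum>i=1..t. \<integral>A. decisions A x i \<partial>M) = (\<integral>A. (\<Sum>i=1..t. decisions A x i) \<partial>M)"
          using int by (simp add: Bochner_Integration.integral_sum)
        also have "\<dots> \<le> (\<integral>A. c \<partial>M)"
        proof (rule integral_mono)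
          fix A assume "A \<in> space M"
          then have A: "A \<in> online_algorithms T c dbar dlo dhi"
            using M by (auto simp: randomized_algorithms_def)
          have "(\<Sum>i=1..t. decisions A x i) \<le> (\<Sum>i=1..T. decisions A x i)"
            by (rule sum_mono2) (use t decisions_nonneg_le(1)[OF A x] in auto)
          also have "\<dots> \<le> c" using A x by (auto simp: online_algorithms_def pmd_feasible_def)
          finally show "(\<Sum>i=1..t. decisions A x i) \<le> c" .
        qed (use int in auto)
        finally show ?thesis by (simp add: prob_space)
      qed
      ultimately show "sum x {1..t} - c \<le> r * sum u {1..t}"
        by (simp add: sum_subtractf sum_distrib_left)
    qed
    then show ?thesis using real R_def by simp
  qed (use R0 R_def in auto)
qed

lemma lower_bound:
  assumes "R \<in> achievable_ratios T c dbar dlo dhi" "t \<in> {1..T}"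
  shows "CR_Compute T c dbar dlo dhi {1..t} \<le> R"
  using assms(1) unfolding achievable_ratios_def
proof (elim UnE imageE)
  fix A assume "R = competitive_ratio T c dbar dlo dhi A" "A \<in> online_algorithms T c dbar dlo dhi"
  then show ?thesis
    using randomized_lower_bound[OF deterministic_as_randomized(1) assms(2)]
      deterministic_as_randomized(2) by metis
next
  fix M assume "R = randomized_competitive_ratio T c dbar dlo dhi M"
    "M \<in> randomized_algorithms T c dbar dlo dhi"
  then show ?thesis using randomized_lower_bound[OF _ assms(2)] by simp
qed

section \<open>A threshold policy that attains the bound\<close>

lemma sum_excess_le:
  assumes d: "d \<in> D"
    and r: "\<And>t. t \<in> {1..T} \<Longrightarrow> c < real t * dhi \<Longrightarrow>
      CR_Compute T c dbar dlo dhi {1..t} \<le> ereal r"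
    and r0: "0 \<le> r"
  shows "(\<Sum>t=1..T. max 0 (d t - r * v (pre t d))) \<le> c"
proof -
  \<comment> \<open>Only these slots contribute to the sum. Their demands, moved to the front in
    order and padded with \<open>dlo\<close>, give the vector \<open>x\<close> of a feasible point,
    to be used with the segment \<open>{1..k}\<close>.\<close>
  define S where "S = {t \<in> {1..T}. 0 < d t - r * v (pre t d)}"
  define k where "k = card S"
  have "finite S" "S \<subseteq> {1..T}" by (auto simp: S_def)
  then have k_le: "k \<le> T" unfolding k_def using card_mono[of "{1..T}" S] by simp
  obtain h where h: "bij_betw h {..<k} S" "strict_mono_on {..<k} h"
    unfolding k_def by (rule ex_bij_betw_strict_mono_card[OF \<open>finite S\<close>])
  \<comment> \<open>\<open>h\<close> counts from 0, slots from 1.\<close>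
  define s where "s = (\<lambda>i. h (i - 1))"
  have "bij_betw (\<lambda>i. i - 1) {1..k} {..<k}"
    by (rule bij_betw_byWitness[where f' = Suc]) auto
  then have s: "bij_betw s {1..k} S"
    using bij_betw_trans[OF _ h(1)] by (simp add: s_def comp_def)
  have sS: "s i \<in> S" "s i \<in> {1..T}" if "i \<in> {1..k}" for i
    using bij_betw_apply[OF s that] \<open>S \<subseteq> {1..T}\<close> by blast+
  define x where "x = (\<lambda>i\<in>{1..T}. if i \<le> k then d (s i) else dlo)"
  have x: "x \<in> D"
    using demandsD[OF d sS(2)] dlo_le_dhi by (auto simp: x_def demands_def PiE_iff)
  \<comment> \<open>An optimal peak for \<open>pre (s i) d\<close> is attainable for
    \<open>pre i x\<close>: slot \<open>j \<le> i\<close> corresponds to slot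
    \<open>s j \<le> s i\<close> with the same demand, and the other \<open>T - i\<close> slots have
    the minimal demand \<open>dlo\<close>.\<close>
  have v_le: "v (pre i x) \<le> v (pre (s i) d)" if i: "i \<in> {1..k}" for i
  proof (rule pmd_value_le)
    show "pre i x \<in> D" using x dlo_le_dhi by (rule prefix_demand_in_demands)
    have pd: "pre (s i) d \<in> D" using d dlo_le_dhi by (rule prefix_demand_in_demands)
    define u where "u = v (pre (s i) d)"
    have lev: "level T c dbar (pre (s i) d) u" unfolding u_def by (rule level_pmd_value[OF pd])
    have inj: "inj_on s {1..i}"
      using s i by (auto simp: bij_betw_def intro: inj_on_subset)
    have s_le: "s j \<le> s i" if "j \<in> {1..i}" for j
      unfolding s_def by (rule strict_mono_on_leD[OF h(2)]) (use that i in auto)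
    have iT: "{1..i} \<subseteq> {1..T}" using i k_le by auto
    have sT: "s ` {1..i} \<subseteq> {1..T}" using sS i by fastforce
    have head: "pre i x j = pre (s i) d (s j)" if "j \<in> {1..i}" for j
      using that i k_le s_le[OF that] sS(2)[of j] by (auto simp: prefix_demand_def x_def)
    have tail: "pre i x j = dlo" if "j \<in> {1..T} - {1..i}" for j
      using that by (auto simp: prefix_demand_def)
    have ge: "dlo \<le> pre (s i) d j" if "j \<in> {1..T}" for j
      using demandsD[OF pd that] by simp
    \<comment> \<open>The required discharges are compared separately on the \<open>i\<close>
      matched slots and on the two complements, which have equal size.\<close>
    have "(\<Sum>j=1..T. max 0 (pre i x j - u)) =
        (\<Sum>j\<in>{1..T} - {1..i}. max 0 (pre i x j - u)) + (\<Sum>j\<in>{1..i}. max 0 (pre i x j - u))"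
      by (rule sum.subset_diff[OF iT]) simp
    also have "(\<Sum>j\<in>{1..T} - {1..i}. max 0 (pre i x j - u)) = real (T - i) * max 0 (dlo - u)"
      using tail iT by (simp add: card_Diff_subset)
    also have "real (T - i) * max 0 (dlo - u) =
        (\<Sum>j\<in>{1..T} - s ` {1..i}. max 0 (dlo - u))"
      using sT card_image[OF inj] by (simp add: card_Diff_subset)
    also have "\<dots> \<le> (\<Sum>j\<in>{1..T} - s ` {1..i}. max 0 (pre (s i) d j - u))"
      by (rule sum_mono) (use ge in force)
    also have "(\<Sum>j\<in>{1..i}. max 0 (pre i x j - u)) =
        (\<Sum>j\<in>s ` {1..i}. max 0 (pre (s i) d j - u))"
      unfolding sum.reindex[OF inj] comp_def by (rule sum.cong) (simp_all only: head)
    also have "(\<Sum>j\<in>{1..T} - s ` {1..i}. max 0 (pre (s i) d j - u)) + \<dots> =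
        (\<Sum>j=1..T. max 0 (pre (s i) d j - u))"
      by (rule sum.subset_diff[OF sT, symmetric]) simp
    also have "\<dots> \<le> c" using lev by (simp add: level_def)
    finally have "(\<Sum>j=1..T. max 0 (pre i x j - u)) \<le> c" by simp
    moreover have "ereal (pre i x j - u) \<le> dbar" if j: "j \<in> {1..T}" for j
    proof (cases "j \<le> i")
      case True
      then have "s j \<in> {1..T}" "pre i x j = pre (s i) d (s j)" using head j sS(2) i by auto
      then show ?thesis using lev by (simp add: level_def)
    next
      case False
      then have "ereal (pre i x j - u) \<le> ereal (pre (s i) d j - u)" using tail ge j by simp
      also have "\<dots> \<le> dbar" using lev j by (simp add: level_def)
      finally show ?thesis .
    qed
    ultimately show "level T c dbar (pre i x) u" using lev by (simp add: level_def)
  qed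
  obtain \<delta> where f: "(x, \<lambda>i. v (pre i x), \<delta>) \<in> cr_feasible T c dbar dlo dhi"
    using cr_feasible_of_pmd_value[OF x] by blast
  \<comment> \<open>The assumption on \<open>r\<close> covers only \<open>k * dhi > c\<close>.
    Otherwise, in particular for \<open>k = 0\<close>, the demands in question total at most
    \<open>c\<close>.\<close>
  have "(\<Sum>i=1..k. x i) - c \<le> r * (\<Sum>i=1..k. v (pre i x))"
  proof (cases "c < real k * dhi")
    case True
    then have "k \<noteq> 0" using c_pos by (intro notI) simp
    then have "k \<in> {1..T}" using k_le by simp
    then show ?thesis using r[OF _ True] f by (intro CR_Compute_geD) auto
  next
    case False
    have "(\<Sum>i=1..k. x i) \<le> (\<Sum>i=1..k. dhi)"
      by (rule sum_mono) (use demandsD[OF x] k_le in auto)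
    also have "\<dots> = real k * dhi" by simp
    finally have "(\<Sum>i=1..k. x i) - c \<le> 0" using False by linarith
    also have "0 \<le> r * (\<Sum>i=1..k. v (pre i x))"
      by (intro mult_nonneg_nonneg r0 sum_nonneg pmd_value_nonneg prefix_demand_in_demands x dlo_le_dhi)
    finally show ?thesis .
  qed
  \<comment> \<open>Replacing each optimum by the smaller one from \<open>v_le\<close> can only
    enlarge the excess.\<close>
  moreover have "(\<Sum>t=1..T. max 0 (d t - r * v (pre t d))) \<le>
      (\<Sum>i=1..k. x i) - r * (\<Sum>i=1..k. v (pre i x))"
  proof -
    have "(\<Sum>t=1..T. max 0 (d t - r * v (pre t d))) = (\<Sum>t\<in>S. d t - r * v (pre t d))"
      by (rule sum.mono_neutral_cong_right) (auto simp: S_def)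
    also have "\<dots> = (\<Sum>i=1..k. d (s i) - r * v (pre (s i) d))"
      by (rule sum.reindex_bij_betw[OF s, symmetric])
    also have "\<dots> \<le> (\<Sum>i=1..k. x i - r * v (pre i x))"
      by (rule sum_mono) (use v_le r0 k_le in \<open>auto simp: x_def intro!: mult_left_mono\<close>)
    finally show ?thesis by (simp add: sum_subtractf sum_distrib_left)
  qed
  ultimately show ?thesis by linarith
qed

text \<open>\<open>r\<close> is the target ratio. List positions count from 0, hence
  \<open>j - 1\<close>; positions past the end of \<open>h\<close> never matter, since
  \<open>pre\<close> puts \<open>dlo\<close> there.\<close>

definition threshold_policy :: "real \<Rightarrow> policy" where
  "threshold_policy r h = max 0 (last h - r * v (pre (length h) (\<lambda>j. h ! (j - 1))))"

lemma decisions_threshold_policy: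
  assumes "t \<in> {1..T}"
  shows "decisions (threshold_policy r) d t = max 0 (d t - r * v (pre t d))"
proof -
  have "pre t (\<lambda>j. history d t ! (j - 1)) = pre t d"
    unfolding prefix_demand_def
    by (rule restrict_ext) (use history_nth[of _ t d] in \<open>simp del: One_nat_def\<close>)
  moreover have "last (history d t) = d t" "length (history d t) = t"
    using assms by (auto simp: history_def)
  ultimately show ?thesis by (simp add: decisions_def threshold_policy_def)
qed

lemma threshold_policy_achieves:
  assumes r: "\<And>t. t \<in> {1..T} \<Longrightarrow> c < real t * dhi \<Longrightarrow>
      CR_Compute T c dbar dlo dhi {1..t} \<le> ereal r"
    and r1: "1 \<le> r"
  shows "threshold_policy r \<in> online_algorithms T c dbar dlo dhi"
    and "competitive_ratio T c dbar dlo dhi (threshold_policy r) \<le> ereal r"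
proof -
  let ?A = "threshold_policy r"
  have feas: "decisions ?A d \<in> pmd_feasible T c dbar d" if d: "d \<in> D" for d
  proof -
    have "(\<Sum>t=1..T. decisions ?A d t) = (\<Sum>t=1..T. max 0 (d t - r * v (pre t d)))"
      by (rule sum.cong) (auto simp: decisions_threshold_policy)
    also have "\<dots> \<le> c" by (rule sum_excess_le[OF d r]) (use r1 in auto)
    finally have "(\<Sum>t=1..T. decisions ?A d t) \<le> c" .
    moreover have "ereal (decisions ?A d t) \<le> dbar" "decisions ?A d t \<le> d t"
      if t: "t \<in> {1..T}" for t
    proof -
      have p: "pre t d \<in> D" using d dlo_le_dhi by (rule prefix_demand_in_demands)
      \<comment> \<open>Since \<open>r \<ge> 1\<close>, the discharge stays below the one that
        attains the offline optimum, which respects \<open>dbar\<close>.\<close>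
      have "v (pre t d) \<le> r * v (pre t d)"
        using pmd_value_nonneg[OF p] r1 by (simp add: mult_le_cancel_right1)
      moreover have "ereal (d t - v (pre t d)) \<le> dbar"
      proof -
        have "pre t d t = d t" using t by (simp add: prefix_demand_def)
        then show ?thesis using level_pmd_value[OF p] t unfolding level_def by metis
      qed
      ultimately have "ereal (d t - r * v (pre t d)) \<le> dbar"
        by (meson diff_left_mono ereal_less_eq(3) order_trans)
      then show "ereal (decisions ?A d t) \<le> dbar"
        using dbar_pos by (auto simp: decisions_threshold_policy[OF t] max_def zero_ereal_def[symmetric])
      show "decisions ?A d t \<le> d t"
        using pmd_value_nonneg[OF p] r1 demandsD[OF d t] dlo_pos
        by (simp add: decisions_threshold_policy[OF t])
    qed
    ultimately show ?thesis by (simp add: pmd_feasible_def decisions_threshold_policy)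
  qed
  then show "?A \<in> online_algorithms T c dbar dlo dhi" by (simp add: online_algorithms_def)
  show "competitive_ratio T c dbar dlo dhi ?A \<le> ereal r"
    unfolding competitive_ratio_def
  proof (rule SUP_least)
    fix d assume d: "d \<in> D"
    have "peak T d (decisions ?A d) \<le> r * v d"
    proof (rule peak_le[OF T_pos])
      fix t assume t: "t \<in> {1..T}"
      \<comment> \<open>Lowering the unseen demands to \<open>dlo\<close> cannot raise the
        optimum.\<close>
      have "v (pre t d) \<le> v d"
        by (intro pmd_value_le prefix_demand_in_demands d dlo_le_dhi
            level_mono[OF level_pmd_value[OF d]] prefix_demand_le[OF d])
      then have "r * v (pre t d) \<le> r * v d" using r1 by (intro mult_left_mono) auto
      then show "d t - decisions ?A d t \<le> r * v d"
        by (simp add: decisions_threshold_policy[OF t])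
    qed
    \<comment> \<open>If \<open>v d = 0\<close>, the peak is 0 as well, and \<open>0 / 0\<close> is
      0.\<close>
    then show "ereal (peak T d (decisions ?A d)) / ereal (v d) \<le> ereal r"
      using peak_nonneg[OF feas[OF d]] pmd_value_nonneg[OF d] r1
      by (cases "v d = 0") (auto simp: divide_ereal_def field_simps)
  qed
qed

end

section \<open>The optimal ratio as a maximum over initial segments\<close>

theorem theorem4p9:
  fixes T :: nat and c dlo dhi :: real and dbar :: ereal
  assumes "T > 0" and "c > 0" and "dbar > 0"
    and "0 < dlo" and "dlo \<le> dhi"
    and "c \<le> real T * dlo"
    and programs_feasible: "ereal c \<le> ereal (real T) * dbar"
    and index_range_nonempty: "nat \<lfloor>c / dhi\<rfloor> < T"
  shows "best_competitive_ratio T c dbar dlo dhi =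
           (MAX I\<in>{{1..t} | t. t \<in> {nat \<lfloor>c / dhi\<rfloor> + 1..T}}. CR_Compute T c dbar dlo dhi I)
         \<and> best_competitive_ratio T c dbar dlo dhi \<in> achievable_ratios T c dbar dlo dhi"
proof -
  interpret pmd T c dlo dhi dbar using assms by unfold_locales auto
  let ?\<tau> = "nat \<lfloor>c / dhi\<rfloor>" and ?CR = "CR_Compute T c dbar dlo dhi"
  let ?S = "{{1..t} | t. t \<in> {?\<tau> + 1..T}}"
  \<comment> \<open>The segments in the maximum are exactly those whose largest possible total
    demand exceeds \<open>c\<close>, the case in which \<open>sum_excess_le\<close> needs
    them.\<close>
  have above: "?\<tau> + 1 \<le> t \<longleftrightarrow> c < real t * dhi" for t
  proof -
    have "0 < dhi" "0 \<le> c / dhi" using dlo_pos dlo_le_dhi c_pos by auto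
    have "?\<tau> + 1 \<le> t \<longleftrightarrow> c / dhi < real t"
      using \<open>0 \<le> c / dhi\<close> by linarith
    then show ?thesis using \<open>0 < dhi\<close> by (simp add: field_simps)
  qed
  have S: "?S = (\<lambda>t. {1..t}) ` {?\<tau> + 1..T}" by auto
  define P where "P = (MAX I\<in>?S. ?CR I)"
  have P_ge: "?CR {1..t} \<le> P" if "t \<in> {1..T}" "c < real t * dhi" for t
    unfolding P_def S by (rule Max_ge) (use that above[of t] in auto)
  have P_mem: "P \<in> ?CR ` ?S"
    unfolding P_def S by (rule Max_in) (use index_range_nonempty in auto)
  then obtain t where t: "t \<in> {?\<tau> + 1..T}" "P = ?CR {1..t}" unfolding S by blast
  then have t: "t \<in> {1..T}" "P = ?CR {1..t}" by simp_all
  have "c < real T * dhi" using above[of T] index_range_nonempty by simp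
  \<comment> \<open>Bounds on both sides make \<open>P\<close> a real number that is admissible as a
    policy parameter.\<close>
  then have "1 \<le> P" using one_le_CR_Compute P_ge[of T] T_pos by (auto intro: order_trans)
  moreover have "P \<le> ereal (real T)" using t CR_Compute_le_T by simp
  ultimately obtain r where r: "P = ereal r" "1 \<le> r"
    by (cases P) (auto simp: one_ereal_def)
  let ?A = "threshold_policy r"
  have A: "?A \<in> online_algorithms T c dbar dlo dhi" "competitive_ratio T c dbar dlo dhi ?A \<le> P"
    using threshold_policy_achieves[of r] P_ge r by auto
  have ach: "competitive_ratio T c dbar dlo dhi ?A \<in> achievable_ratios T c dbar dlo dhi"
    using A(1) by (simp add: achievable_ratios_def)
  have lower: "P \<le> R" if "R \<in> achievable_ratios T c dbar dlo dhi" for R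
    using lower_bound[OF that t(1)] t(2) by simp
  \<comment> \<open>The ratio of the policy is at most \<open>P\<close> and, being achievable, also
    at least \<open>P\<close>.\<close>
  have P_ach: "P \<in> achievable_ratios T c dbar dlo dhi"
    using ach lower[OF ach] A(2) by simp
  then have "best_competitive_ratio T c dbar dlo dhi = P"
    unfolding best_competitive_ratio_def using lower by (intro antisym Inf_lower Inf_greatest)
  then show ?thesis using P_ach P_def by simp
qed

end
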